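(* Let $1<p<\infty$ and let $f\in C(K)$. If there exist $g\in L^p(K,\mu)$ and a $\mu$-null set $N\subset K$ such that \[ |f(x)-f(y)|\le d(x,y)^{\alpha_p}\big(g(x)+g(y)\big)\qquad\text{for all }x,y\in K\setminus N, \] then $f$ is constant.
   Context: Vicsek set. In $\mathbb R^2$ let $q_1=(-\sqrt2/2,\sqrt2/2)$, $q_2=(\sqrt2/2,\sqrt2/2)$, $q_3=(\sqrt2/2,-\sqrt2/2)$, $q_4=(-\sqrt2/2,-\sqrt2/2)$, $q_5=(0,0)$ and $\psi_i(z)=\frac13(z-q_i)+q_i$, $1\le i\le5$. $K$ is the unique non-empty compact set with $K=\bigcup_{i=1}^5\psi_i(K)$. Geodesic distance. Let $\bar V_0$ be the union of the four segments $[q_5,q_i]$, $1\le i\le4$, and $\bar V_{n+1}=\bigcup_i\psi_i(\bar V_n)$; each $\bar V_n\subset K$ is a tree and $\bigcup_n\bar V_n$ is dense in $K$. For $x,y\in\bar V_n$, $d(x,y)$ is the length of the path in $\bar V_n$ from $x$ to $y$, and $d$ is extended by continuity to $K\times K$. $\mu$ is the Borel probability measure on $K$ with $\mu(\psi_{i_1}\circ\cdots\circ\psi_{i_n}(K))=5^{-n}$; $d_h=\log5/\log3$ and $\alpha_p=1-\frac1p+\frac{d_h}p$. *)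

theory Defs
  imports "HOL-Probability.Probability"
begin

type_synonym plane = "real \<times> real"

text \<open>The norm and the metric of the product type \<open>real \<times> real\<close> are the Euclidean ones.\<close>

definition q :: "nat \<Rightarrow> plane" where
  "q i = (if i = 1 then (- sqrt 2 / 2, sqrt 2 / 2)
          else if i = 2 then (sqrt 2 / 2, sqrt 2 / 2)
          else if i = 3 then (sqrt 2 / 2, - sqrt 2 / 2)
          else if i = 4 then (- sqrt 2 / 2, - sqrt 2 / 2)
          else (0, 0))"

definition \<psi> :: "nat \<Rightarrow> plane \<Rightarrow> plane" where
  "\<psi> i z = (1/3) *\<^sub>R (z - q i) + q i"

definition is_vicsek_set :: "plane set \<Rightarrow> bool" where
  "is_vicsek_set A \<longleftrightarrow> A \<noteq> {} \<and> compact A \<and> A = (\<Union>i\<in>{1..5}. \<psi> i ` A)"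

text \<open>The definite description is justified by \<open>ex1_vicsek_set\<close> below.\<close>

definition vicsek :: "plane set" where
  "vicsek = (THE A. is_vicsek_set A)"

lemma norm_q_le: "norm (q i) \<le> 1"
  by (auto simp: q_def norm_Pair power_divide)

lemma dist_\<psi>: "dist (\<psi> i x) (\<psi> i y) = dist x y / 3"
proof -
  have "\<psi> i x - \<psi> i y = (1/3) *\<^sub>R (x - y)"
    by (simp add: \<psi>_def algebra_simps)
  then show ?thesis
    by (simp add: dist_norm)
qed

lemma inj_\<psi>: "inj (\<psi> i)"
  by (rule injI) (metis dist_\<psi> dist_eq_0_iff divide_eq_0_iff zero_neq_numeral)

lemma continuous_on_\<psi>: "continuous_on A (\<psi> i)"
  unfolding \<psi>_def by (intro continuous_intros)

lemma is_vicsek_set_subset: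
  assumes A: "is_vicsek_set A" and B: "is_vicsek_set B"
  shows "A \<subseteq> B"
proof -
  have cA: "compact A" "A \<noteq> {}" "A = (\<Union>i\<in>{1..5}. \<psi> i ` A)"
    and cB: "compact B" "B \<noteq> {}" "B = (\<Union>i\<in>{1..5}. \<psi> i ` B)"
    using A B by (auto simp: is_vicsek_set_def)
  have "continuous_on A (\<lambda>x. infdist x B)"
    by (intro continuous_intros)
  then obtain a where a: "a \<in> A" "\<And>x. x \<in> A \<Longrightarrow> infdist x B \<le> infdist a B"
    using continuous_attains_sup[OF cA(1,2)] by blast
  obtain i a' where i: "i \<in> {1..5}" "a' \<in> A" "a = \<psi> i a'"
    using a(1) cA(3) by blast
  obtain b where b: "b \<in> B" "infdist a' B = dist a' b"
    using infdist_attains_inf[OF compact_imp_closed[OF cB(1)] cB(2)] by metis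
  have "\<psi> i b \<in> B"
    using cB(3) i(1) b(1) by blast
  then have "infdist a B \<le> dist a' b / 3"
    using infdist_le[of "\<psi> i b" B a] by (simp add: i(3) dist_\<psi>)
  also have "\<dots> \<le> infdist a B / 3"
    using a(2)[OF i(2)] b(2) by simp
  finally have le0: "infdist a B \<le> 0"
    by simp
  show ?thesis
  proof
    fix x assume "x \<in> A"
    then have "infdist x B = 0"
      using a(2)[of x] le0 infdist_nonneg[of x B] by linarith
    then show "x \<in> B"
      using in_closed_iff_infdist_zero[OF compact_imp_closed[OF cB(1)] cB(2)] by blast
  qed
qed

lemma ex_vicsek_set: "\<exists>A. is_vicsek_set A"
proof -
  define F where "F = (\<lambda>A. \<Union>i\<in>{1..5}. \<psi> i ` A)"
  define S where "S = (\<lambda>n. (F ^^ n) (cball 0 1))"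
  define A where "A = (\<Inter>n. S n)"
  have S_Suc: "S (Suc n) = F (S n)" for n
    by (simp add: S_def)
  have mono: "F X \<subseteq> F Y" if "X \<subseteq> Y" for X Y
    using that by (auto simp: F_def)
  have "\<psi> i x \<in> cball 0 1" if "x \<in> cball 0 1" for i x
  proof -
    have "\<psi> i x = (1/3) *\<^sub>R x + (2/3) *\<^sub>R q i"
      by (simp add: \<psi>_def algebra_simps) (simp flip: scaleR_add_left)
    then have "norm (\<psi> i x) \<le> norm x / 3 + 2/3 * norm (q i)"
      using norm_triangle_ineq[of "(1/3) *\<^sub>R x" "(2/3) *\<^sub>R q i"] by simp
    with that norm_q_le[of i] show ?thesis by simp
  qed
  then have "S (Suc 0) \<subseteq> S 0"
    by (auto simp: S_def F_def)
  then have S_dec1: "S (Suc n) \<subseteq> S n" for n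
    by (induction n) (auto simp: S_Suc intro: mono[THEN subsetD])
  have S_dec: "S n \<subseteq> S m" if "m \<le> n" for m n
    using lift_Suc_antimono_le[of S, OF S_dec1 that] .
  have S_compact: "compact (S n)" for n
  proof (induction n)
    case 0 then show ?case by (simp add: S_def)
  next
    case (Suc n)
    then show ?case
      unfolding S_Suc F_def
      by (intro compact_UN ballI compact_continuous_image continuous_on_\<psi>) auto
  qed
  have "\<psi> 5 0 = 0"
    by (simp add: \<psi>_def q_def flip: zero_prod_def)
  then have "0 \<in> S n" for n
  proof (induction n)
    case (Suc n)
    then show ?case
      unfolding S_Suc F_def by (intro UN_I[of 5]) (auto intro: rev_image_eqI)
  qed (simp add: S_def)
  then have "A \<noteq> {}"
    by (auto simp: A_def)
  moreover have "compact A"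
    unfolding A_def by (intro compact_Inter) (auto simp: S_compact)
  moreover have "A = F A"
  proof
    show "F A \<subseteq> A"
    proof -
      have "F A \<subseteq> S n" for n
        using mono[of A "S n"] S_dec1[of n] by (auto simp: A_def S_Suc)
      then show ?thesis by (auto simp: A_def)
    qed
    show "A \<subseteq> F A"
    proof
      fix x assume "x \<in> A"
      then have "x \<in> F (S n)" for n
        unfolding A_def S_Suc[symmetric] by blast
      then have "\<forall>n. \<exists>i\<in>{1..5}. x \<in> \<psi> i ` S n"
        unfolding F_def by blast
      then obtain c where c: "\<And>n. c n \<in> {1..5::nat}" "\<And>n. x \<in> \<psi> (c n) ` S n"
        by metis
      have "finite (range c)"
        by (rule finite_subset[of _ "{1..5}"]) (use c(1) in auto)
      then obtain k where k: "infinite {n. c n = c k}"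
        using pigeonhole_infinite[of UNIV c] by auto
      have "x \<in> \<psi> (c k) ` S n" for n
      proof -
        obtain m where "m \<ge> n" "c m = c k"
          using k unfolding infinite_nat_iff_unbounded_le by blast
        with c(2)[of m] S_dec[of n m] show ?thesis by auto
      qed
      then have "x \<in> \<psi> (c k) ` A"
        unfolding A_def using image_INT[OF inj_\<psi>[of "c k"], of UNIV S 0] by auto
      then show "x \<in> F A"
        using c(1) by (auto simp: F_def)
    qed
  qed
  ultimately show ?thesis
    unfolding is_vicsek_set_def F_def by blast
qed

lemma ex1_vicsek_set: "\<exists>!A. is_vicsek_set A"
  using ex_vicsek_set is_vicsek_set_subset by (metis subset_antisym)

lemma is_vicsek_set_vicsek: "is_vicsek_set vicsek"
  unfolding vicsek_def by (rule theI'[OF ex1_vicsek_set])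

text \<open>\<open>\<psi>w [i\<^sub>1, \<dots>, i\<^sub>n] = \<psi> i\<^sub>1 \<circ> \<dots> \<circ> \<psi> i\<^sub>n\<close>\<close>

definition \<psi>w :: "nat list \<Rightarrow> plane \<Rightarrow> plane" where
  "\<psi>w w = foldr \<psi> w"

fun Vbar :: "nat \<Rightarrow> plane set" where
  "Vbar 0 = (\<Union>i\<in>{1..4}. closed_segment (q 5) (q i))"
| "Vbar (Suc n) = (\<Union>i\<in>{1..5}. \<psi> i ` Vbar n)"

text \<open>Length of a curve parametrised by \<open>{0..1}\<close>: the supremum of the lengths of its
  inscribed polygons, possibly infinite.\<close>

definition curve_length :: "(real \<Rightarrow> 'a::metric_space) \<Rightarrow> ereal" where
  "curve_length \<gamma> =
     (SUP (t, n) \<in> {(t :: nat \<Rightarrow> real, n :: nat). mono t \<and> range t \<subseteq> {0..1}}.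
        ereal (\<Sum>i<n. dist (\<gamma> (t i)) (\<gamma> (t (Suc i)))))"

text \<open>The path from \<open>x\<close> to \<open>y \<noteq> x\<close> in the tree \<open>Vbar n\<close> is the arc in \<open>Vbar n\<close>
  joining them; its image is unique, and its length does not depend on the parametrisation.
  As the union of the \<open>Vbar n\<close> is dense in \<open>vicsek\<close>, the following properties determine
  \<open>d\<close> on \<open>vicsek \<times> vicsek\<close>; nothing is required of \<open>d\<close> elsewhere.\<close>

definition is_geodesic_dist :: "(plane \<Rightarrow> plane \<Rightarrow> real) \<Rightarrow> bool" where
  "is_geodesic_dist d \<longleftrightarrow>
     (\<forall>n. \<forall>x\<in>Vbar n. d x x = 0) \<and>
     (\<forall>n. \<forall>x\<in>Vbar n. \<forall>y\<in>Vbar n. \<forall>\<gamma>.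
        arc \<gamma> \<and> path_image \<gamma> \<subseteq> Vbar n \<and> pathstart \<gamma> = x \<and> pathfinish \<gamma> = y
        \<longrightarrow> ereal (d x y) = curve_length \<gamma>) \<and>
     continuous_on (vicsek \<times> vicsek) (\<lambda>(x, y). d x y)"

text \<open>The space of such a measure is \<open>vicsek\<close>.\<close>

definition is_vicsek_measure :: "plane measure \<Rightarrow> bool" where
  "is_vicsek_measure \<mu> \<longleftrightarrow>
     sets \<mu> = sets (restrict_space borel vicsek) \<and>
     prob_space \<mu> \<and>
     (\<forall>w. set w \<subseteq> {1..5} \<longrightarrow> measure \<mu> (\<psi>w w ` vicsek) = 1 / 5 ^ length w)"

definition d\<^sub>h :: real where
  "d\<^sub>h = ln 5 / ln 3"

definition \<alpha> :: "real \<Rightarrow> real" where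
  "\<alpha> p = 1 - 1 / p + d\<^sub>h / p"

text \<open>Real-valued functions with \<open>p\<close>-integrable absolute value (representatives, not classes
  modulo almost everywhere equality).\<close>

definition Lp_fun :: "real \<Rightarrow> 'a measure \<Rightarrow> ('a \<Rightarrow> real) \<Rightarrow> bool" where
  "Lp_fun p \<mu> g \<longleftrightarrow> g \<in> borel_measurable \<mu> \<and> integrable \<mu> (\<lambda>x. \<bar>g x\<bar> powr p)"

end

theory Submission
  imports Defs
begin

text \<open>Let \<open>h = \<bar>g\<bar>\<^sup>p\<close>. In every cell \<open>K\<^sub>w\<close> of level \<open>m\<close> choose a point \<open>x\<^sub>w \<notin> N\<close> at which \<open>h\<close> is
  at most its average over \<open>K\<^sub>w\<close>. A diagonal of a fixed cell is covered at depth \<open>n\<close> by a chain of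
  \<open>3\<^sup>n\<close> cells, in which consecutive points are at distance \<open>O(3\<^sup>-\<^sup>m)\<close>. Adding up the hypothesis along
  the chain, the exponent \<open>\<alpha> p\<close> is exactly the one for which Hoelder's inequality (here
  replaced by the pointwise \<open>a \<le> e + e\<^sup>1\<^sup>-\<^sup>p a\<^sup>p\<close>) bounds the difference of \<open>f\<close> at the two ends by a constant times the \<open>L\<^sup>p\<close> norm of \<open>g\<close> over the cells of the
  chain. These cells have total measure \<open>O((3/5)\<^sup>n)\<close>, so this tends to \<open>0\<close>, and \<open>f\<close> takes the same
  value at opposite corners of every cell. Applied to the nested cells shrinking to a centre, this
  shows that \<open>f\<close> has the same value at all corners and centres, which are dense.\<close>

section \<open>The Vicsek set and its finite trees\<close>

lemma \<psi>w_Nil [simp]: "\<psi>w [] x = x"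
  and \<psi>w_Cons [simp]: "\<psi>w (a # w) x = \<psi> a (\<psi>w w x)"
  and \<psi>w_append [simp]: "\<psi>w (v @ w) x = \<psi>w v (\<psi>w w x)"
  by (simp_all add: \<psi>w_def)

lemma \<psi>_shift: "\<psi> i x = \<psi> i y + (1/3) *\<^sub>R (x - y)"
  by (simp add: \<psi>_def algebra_simps)

text \<open>Each \<open>\<psi> i\<close> has linear part \<open>1/3\<close>, without rotation. The
  free base point \<open>y\<close> allows expansion around a joint of two cells.\<close>

lemma \<psi>w_shift: "\<psi>w w x = \<psi>w w y + (1/3) ^ length w *\<^sub>R (x - y)"
proof (induction w)
  case (Cons a w)
  then show ?case
    using \<psi>_shift[of a "\<psi>w w x" "\<psi>w w y"] by simp
qed simp

lemma dist_\<psi>w: "dist (\<psi>w w x) (\<psi>w w y) = (1/3) ^ length w * dist x y"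
  by (subst \<psi>w_shift[of w x y]) (simp add: dist_norm)

lemma continuous_on_\<psi>w: "continuous_on A (\<psi>w w)"
proof (induction w)
  case (Cons a w)
  then show ?case
    using continuous_on_compose2[OF continuous_on_\<psi>[of UNIV a] Cons] by (simp add: \<psi>w_def)
qed (simp add: \<psi>w_def)

lemma \<psi>_q [simp]: "\<psi> i (q i) = q i"
  by (simp add: \<psi>_def)

lemma q_5 [simp]: "q 5 = 0"
  by (simp add: q_def zero_prod_def)

lemma \<psi>w_replicate_q [simp]: "\<psi>w (replicate n i) (q i) = q i"
  by (induction n) auto

text \<open>The index of the antipodal corner; the last branch is meant for \<open>4\<close> and
  gives all other indices a default value.\<close>

definition opp :: "nat \<Rightarrow> nat" where
  "opp i = (if i = 1 then 3 else if i = 2 then 4 else if i = 3 then 1 else 2)"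

lemma opp_in: "i \<in> {1..4} \<Longrightarrow> opp i \<in> {1..4}"
  by (simp add: opp_def)

lemma atLeastAtMost_1_4: "i \<in> {1..4::nat} \<longleftrightarrow> i = 1 \<or> i = 2 \<or> i = 3 \<or> i = 4"
  by auto

lemma opp_opp: "i \<in> {1..4} \<Longrightarrow> opp (opp i) = i"
  by (auto simp: opp_def atLeastAtMost_1_4)

lemma opp_neq: "i \<in> {1..4} \<Longrightarrow> opp i \<noteq> i"
  by (auto simp: opp_def)

lemma q_opp: "i \<in> {1..4} \<Longrightarrow> q (opp i) = - q i"
  by (auto simp: opp_def q_def atLeastAtMost_1_4)

text \<open>Both sides are one third of \<open>q i\<close>, the point at which the corner cell
  \<open>i\<close> touches the central cell. The gluing of cells goes through it.\<close>

lemma \<psi>_opp: "i \<in> {1..4} \<Longrightarrow> \<psi> i (q (opp i)) = \<psi> 5 (q i)"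
  by (simp add: q_opp \<psi>_def algebra_simps flip: scaleR_add_left)

section \<open>The set as the closure of its finite trees\<close>

lemma vicsek_eq: "vicsek = (\<Union>i\<in>{1..5}. \<psi> i ` vicsek)"
  and compact_vicsek: "compact vicsek"
  using is_vicsek_set_vicsek by (auto simp: is_vicsek_set_def)

text \<open>The arm from the centre to \<open>q i\<close> is cut into thirds. The inner one lies in
  the central cell; the middle and outer ones lie in cell \<open>i\<close>, as images of the arms to
  \<open>q (opp i)\<close> and \<open>q i\<close>.\<close>

lemma Vbar_0_subset_Suc: "Vbar 0 \<subseteq> Vbar (Suc 0)"
proof
  fix x assume "x \<in> Vbar 0"
  then obtain i u where i: "i \<in> {1..4::nat}" and u: "0 \<le> u" "u \<le> 1" "x = u *\<^sub>R q i"
    by (auto simp: closed_segment_def)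
  have mem: "t *\<^sub>R q k \<in> Vbar 0" if "k \<in> {1..4}" "0 \<le> t" "t \<le> 1" for t and k :: nat
    using that by (auto simp: closed_segment_def)
  consider "u \<le> 1/3" | "1/3 \<le> u" "u \<le> 2/3" | "2/3 \<le> u" by linarith
  then have "\<exists>k\<in>{1..5}. \<exists>y\<in>Vbar 0. x = \<psi> k y"
  proof cases
    case 1
    then show ?thesis
      using mem[OF i, of "3 * u"] u
      by (intro bexI[of _ 5] bexI[of _ "(3 * u) *\<^sub>R q i"]) (auto simp: \<psi>_def)
  next
    case 2
    then show ?thesis
      using mem[OF opp_in[OF i], of "2 - 3 * u"] u i
      by (intro bexI[of _ i] bexI[of _ "(2 - 3 * u) *\<^sub>R q (opp i)"])
         (auto simp: \<psi>_def q_opp algebra_simps simp flip: scaleR_add_left)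
  next
    case 3
    then show ?thesis
      using mem[OF i, of "3 * u - 2"] u i
      by (intro bexI[of _ i] bexI[of _ "(3 * u - 2) *\<^sub>R q i"])
         (auto simp: \<psi>_def algebra_simps simp flip: scaleR_add_left)
  qed
  then show "x \<in> Vbar (Suc 0)" by auto
qed

lemma Vbar_subset_Suc: "Vbar n \<subseteq> Vbar (Suc n)"
proof (induction n)
  case 0
  show ?case by (rule Vbar_0_subset_Suc)
next
  case (Suc n)
  then have "\<psi> i ` Vbar n \<subseteq> \<psi> i ` Vbar (Suc n)" for i
    by (rule image_mono)
  then have "(\<Union>i\<in>{1..5}. \<psi> i ` Vbar n) \<subseteq> (\<Union>i\<in>{1..5}. \<psi> i ` Vbar (Suc n))"
    by (rule UN_mono[OF order_refl])
  then show ?case by (simp only: Vbar.simps)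
qed

lemma Vbar_mono: "m \<le> n \<Longrightarrow> Vbar m \<subseteq> Vbar n"
  using lift_Suc_mono_le[of Vbar, OF Vbar_subset_Suc] .

lemma norm_\<psi>_le: "norm x \<le> 1 \<Longrightarrow> norm (\<psi> i x) \<le> 1"
proof -
  assume x: "norm x \<le> 1"
  have "\<psi> i x = (1/3) *\<^sub>R x + (2/3) *\<^sub>R q i"
    by (simp add: \<psi>_def algebra_simps) (simp flip: scaleR_add_left)
  then have "norm (\<psi> i x) \<le> norm x / 3 + 2/3 * norm (q i)"
    using norm_triangle_ineq[of "(1/3) *\<^sub>R x" "(2/3) *\<^sub>R q i"] by simp
  with x norm_q_le[of i] show ?thesis by simp
qed

lemma norm_Vbar_le: "x \<in> Vbar n \<Longrightarrow> norm x \<le> 1"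
proof (induction n arbitrary: x)
  case 0
  then obtain i u where "0 \<le> u" "u \<le> 1" "x = u *\<^sub>R q i"
    by (auto simp: closed_segment_def)
  then show ?case using norm_q_le[of i] by (simp add: mult_le_one)
next
  case (Suc n)
  then show ?case by (auto intro: norm_\<psi>_le)
qed

lemma closure_UN_finite:
  "finite I \<Longrightarrow> closure (\<Union>i\<in>I. A i) = (\<Union>i\<in>I. closure (A i))"
  by (induction I rule: finite_induct) auto

text \<open>The closure is non-empty, compact and invariant under the five maps, so uniqueness of
  such a set identifies it.\<close>

lemma vicsek_eq_closure: "vicsek = closure (\<Union>n. Vbar n)" (is "_ = closure ?U")
proof -
  have inv: "?U = (\<Union>i\<in>{1..5}. \<psi> i ` ?U)"
  proof
    show "?U \<subseteq> (\<Union>i\<in>{1..5}. \<psi> i ` ?U)"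
    proof
      fix x assume "x \<in> ?U"
      then obtain n where "x \<in> Vbar n" by blast
      then have "x \<in> Vbar (Suc n)" using Vbar_subset_Suc by blast
      then obtain i y where "i \<in> {1..5}" "y \<in> Vbar n" "x = \<psi> i y" by auto
      then show "x \<in> (\<Union>i\<in>{1..5}. \<psi> i ` ?U)" by blast
    qed
    show "(\<Union>i\<in>{1..5}. \<psi> i ` ?U) \<subseteq> ?U"
    proof
      fix x assume "x \<in> (\<Union>i\<in>{1..5}. \<psi> i ` ?U)"
      then obtain i n y where "i \<in> {1..5}" "y \<in> Vbar n" "x = \<psi> i y" by blast
      then have "x \<in> Vbar (Suc n)" by auto
      then show "x \<in> ?U" by blast
    qed
  qed
  have bdd: "bounded ?U"
    unfolding bounded_iff by (intro exI[of _ 1]) (auto intro: norm_Vbar_le)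
  then have cpt: "compact (closure ?U)"
    by simp
  \<comment> \<open>The inclusion from right to left rests on compactness of the image of the
    closure.\<close>
  have img: "\<psi> i ` closure ?U = closure (\<psi> i ` ?U)" for i
  proof
    show "\<psi> i ` closure ?U \<subseteq> closure (\<psi> i ` ?U)"
      by (intro image_closure_subset[OF continuous_on_\<psi>] closed_closure closure_subset)
    have "compact (\<psi> i ` closure ?U)"
      by (intro compact_continuous_image continuous_on_\<psi> cpt)
    then show "closure (\<psi> i ` ?U) \<subseteq> \<psi> i ` closure ?U"
      by (intro closure_minimal image_mono closure_subset compact_imp_closed)
  qed
  have "closure ?U = closure (\<Union>i\<in>{1..5}. \<psi> i ` ?U)"
    by (rule arg_cong[OF inv])
  also have "\<dots> = (\<Union>i\<in>{1..5}. closure (\<psi> i ` ?U))"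
    by (rule closure_UN_finite) simp
  finally have "closure ?U = (\<Union>i\<in>{1..5}. \<psi> i ` closure ?U)"
    unfolding img .
  moreover have "closure ?U \<noteq> {}"
  proof -
    have "q 1 \<in> Vbar 0" by (auto intro!: bexI[of _ 1])
    then have "?U \<noteq> {}" by blast
    then show ?thesis by (simp only: closure_eq_empty not_False_eq_True)
  qed
  ultimately have "is_vicsek_set (closure ?U)"
    using cpt unfolding is_vicsek_set_def by blast
  then show ?thesis
    using ex1_vicsek_set is_vicsek_set_vicsek by blast
qed

lemma Vbar_subset_vicsek: "Vbar n \<subseteq> vicsek"
proof -
  have "Vbar n \<subseteq> (\<Union>n. Vbar n)" by blast
  also have "\<dots> \<subseteq> vicsek"
    unfolding vicsek_eq_closure by (rule closure_subset)
  finally show ?thesis .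
qed

lemma norm_vicsek_le: "x \<in> vicsek \<Longrightarrow> norm x \<le> 1"
proof -
  have "vicsek \<subseteq> cball 0 1"
    unfolding vicsek_eq_closure by (rule closure_minimal) (auto simp: norm_Vbar_le)
  then show "x \<in> vicsek \<Longrightarrow> norm x \<le> 1" by auto
qed

lemma q_in_Vbar: "i \<in> {1..5} \<Longrightarrow> q i \<in> Vbar n"
proof -
  assume i: "i \<in> {1..5}"
  have "q i \<in> Vbar 0"
  proof (cases "i = 5")
    case True
    then show ?thesis by (auto intro!: bexI[of _ 1])
  next
    case False
    with i show ?thesis by (auto intro!: bexI[of _ i])
  qed
  then show ?thesis using Vbar_mono[of 0 n] by blast
qed

lemma q_in_vicsek: "i \<in> {1..5} \<Longrightarrow> q i \<in> vicsek"
  using q_in_Vbar Vbar_subset_vicsek by blast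

lemma \<psi>_in_vicsek: "i \<in> {1..5} \<Longrightarrow> x \<in> vicsek \<Longrightarrow> \<psi> i x \<in> vicsek"
  using vicsek_eq by blast

lemma \<psi>w_in_vicsek: "set w \<subseteq> {1..5} \<Longrightarrow> x \<in> vicsek \<Longrightarrow> \<psi>w w x \<in> vicsek"
  by (induction w) (auto simp del: atLeastAtMost_iff intro: \<psi>_in_vicsek)

lemma \<psi>w_in_Vbar: "set w \<subseteq> {1..5} \<Longrightarrow> x \<in> Vbar n \<Longrightarrow> \<psi>w w x \<in> Vbar (length w + n)"
  by (induction w) auto

section \<open>Path connectedness of the trees\<close>

lemma path_connected_\<psi>_image: "path_connected S \<Longrightarrow> path_connected (\<psi> i ` S)"
  by (rule path_connected_continuous_image[OF continuous_on_\<psi>])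

text \<open>The two copies of \<open>S\<close> meet at the point of \<open>\<psi>_opp\<close>. This
  serves both the induction over the trees and the comparison of neighbouring cells.\<close>

lemma path_connected_wedge:
  assumes S: "path_connected S" and i: "i \<in> {1..4}" and q: "q i \<in> S" "q (opp i) \<in> S"
  shows "path_connected (\<psi> i ` S \<union> \<psi> 5 ` S)"
proof (rule path_connected_Un)
  have "\<psi> i (q (opp i)) \<in> \<psi> i ` S \<inter> \<psi> 5 ` S"
    using imageI[OF q(2), of "\<psi> i"] imageI[OF q(1), of "\<psi> 5"] \<psi>_opp[OF i] by simp
  then show "\<psi> i ` S \<inter> \<psi> 5 ` S \<noteq> {}" by blast
qed (auto intro: path_connected_\<psi>_image S)

text \<open>Level \<open>0\<close> is a star about the centre. Each further level is a union of four
  wedges, each made of a corner copy and the central copy, so all of them contain the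
  centre.\<close>

lemma path_connected_Vbar: "path_connected (Vbar n)"
proof (induction n)
  case 0
  have "starlike (Vbar 0)"
    unfolding starlike_def
  proof (intro bexI ballI)
    show "q 5 \<in> Vbar 0" by (rule q_in_Vbar) simp
    fix x assume "x \<in> Vbar 0"
    then obtain i where i: "i \<in> {1..4}" "x \<in> closed_segment (q 5) (q i)" by auto
    have "closed_segment (q 5) x \<subseteq> closed_segment (q 5) (q i)"
      using i(2) by (simp add: subset_closed_segment)
    then show "closed_segment (q 5) x \<subseteq> Vbar 0"
      using i(1) by (auto simp del: q_5)
  qed
  then show ?case by (rule starlike_imp_path_connected)
next
  case (Suc n)
  have eq: "Vbar (Suc n) = (\<Union>i\<in>{1..4}. \<psi> i ` Vbar n \<union> \<psi> 5 ` Vbar n)"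
  proof -
    have "{1..5::nat} = insert 5 {1..4}" by auto
    then show ?thesis by (auto simp: atLeastAtMost_1_4)
  qed
  have z: "\<psi> 5 (q 5) \<in> \<psi> 5 ` Vbar n"
    by (intro imageI q_in_Vbar) auto
  have pc: "path_connected (\<psi> i ` Vbar n \<union> \<psi> 5 ` Vbar n)" if "i \<in> {1..4}" for i
  proof (rule path_connected_wedge[OF Suc that])
    show "q i \<in> Vbar n" using that by (intro q_in_Vbar) auto
    show "q (opp i) \<in> Vbar n" using opp_in[OF that] by (intro q_in_Vbar) auto
  qed
  show ?case
    unfolding eq by (rule path_connected_UNION) (use pc z in \<open>auto simp del: q_5\<close>)
qed

section \<open>The geodesic distance between neighbouring cells\<close>

lemma curve_length_nonneg: "0 \<le> curve_length \<gamma>"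
proof -
  have "0 = ereal (\<Sum>i<0. dist (\<gamma> ((\<lambda>_. 0) i)) (\<gamma> ((\<lambda>_. 0) (Suc i))))"
    by simp
  also have "\<dots> \<le> curve_length \<gamma>"
    unfolding curve_length_def
    by (rule SUP_upper2[of "(\<lambda>_. 0, 0)"]) (auto simp: mono_def)
  finally show ?thesis by simp
qed

lemma curve_length_scale_le:
  assumes S: "\<And>x y. dist (S x) (S y) = r * dist x y" and r: "0 \<le> r"
    and L: "curve_length \<gamma> = ereal L"
  shows "curve_length (S \<circ> \<gamma>) \<le> ereal (r * L)"
  unfolding curve_length_def
proof (rule SUP_least, clarify)
  fix t :: "nat \<Rightarrow> real" and n :: nat
  assume t: "mono t" "range t \<subseteq> {0..1}"
  have "ereal (\<Sum>i<n. dist (\<gamma> (t i)) (\<gamma> (t (Suc i)))) \<le> curve_length \<gamma>"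
    unfolding curve_length_def by (rule SUP_upper2[of "(t, n)"]) (use t in auto)
  then have "(\<Sum>i<n. dist (\<gamma> (t i)) (\<gamma> (t (Suc i)))) \<le> L"
    using L by simp
  then show "ereal (\<Sum>i<n. dist ((S \<circ> \<gamma>) (t i)) ((S \<circ> \<gamma>) (t (Suc i)))) \<le> ereal (r * L)"
    using r by (simp add: S mult_left_mono flip: sum_distrib_left)
qed

text \<open>At distinct points \<open>d\<close> is known only through arcs, so an arc from
  \<open>a\<close> to \<open>b\<close> inside \<open>X\<close> is transported by \<open>S\<close>:
  its image is an arc in \<open>Vbar n\<close>, of length at most \<open>r\<close> times the
  original one.\<close>

lemma geodesic_dist_scale_le:
  assumes d: "is_geodesic_dist d"
    and S: "\<And>x. S x = r *\<^sub>R x + c" and r: "0 < r"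
    and X: "path_connected X" "X \<subseteq> Vbar m" "S ` X \<subseteq> Vbar n"
    and ab: "a \<in> X" "b \<in> X"
  shows "0 \<le> d (S a) (S b)" "d (S a) (S b) \<le> r * d a b"
proof -
  have 0: "d x x = 0" if "x \<in> Vbar k" for x k
    using d that unfolding is_geodesic_dist_def by blast
  have len: "ereal (d (pathstart \<gamma>) (pathfinish \<gamma>)) = curve_length \<gamma>"
    if "arc \<gamma>" "path_image \<gamma> \<subseteq> Vbar k" for \<gamma> k
    using d that unfolding is_geodesic_dist_def
    by (metis pathstart_in_path_image pathfinish_in_path_image subsetD)
  have "0 \<le> d (S a) (S b) \<and> d (S a) (S b) \<le> r * d a b"
  proof (cases "a = b")
    \<comment> \<open>No arc joins a point to itself, so the separate clause
      \<open>d x x = 0\<close> is used.\<close>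
    case True
    then show ?thesis using ab X 0 by (metis imageI mult_zero_right order_refl subsetD)
  next
    case False
    then obtain \<gamma> where \<gamma>: "arc \<gamma>" "path_image \<gamma> \<subseteq> X" "pathstart \<gamma> = a" "pathfinish \<gamma> = b"
      using X(1) ab unfolding path_connected_arcwise by metis
    have distS: "dist (S x) (S y) = r * dist x y" for x y
      using r by (simp add: S dist_norm flip: scaleR_diff_right)
    have arcS: "arc (S \<circ> \<gamma>)"
      unfolding arc_def
    proof
      show "path (S \<circ> \<gamma>)"
        by (rule path_continuous_image[OF arc_imp_path[OF \<gamma>(1)]]) (auto simp: S intro!: continuous_intros)
      show "inj_on (S \<circ> \<gamma>) {0..1}"
        using \<gamma>(1) r unfolding arc_def by (intro comp_inj_on) (auto simp: inj_on_def S)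
    qed
    have "path_image (S \<circ> \<gamma>) \<subseteq> Vbar n"
      using \<gamma>(2) X(3) by (auto simp: path_image_compose)
    from len[OF arcS this] have e: "ereal (d (S a) (S b)) = curve_length (S \<circ> \<gamma>)"
      by (simp add: pathstart_compose pathfinish_compose \<gamma>)
    have "path_image \<gamma> \<subseteq> Vbar m" using \<gamma>(2) X(2) by blast
    from len[OF \<gamma>(1) this] have "curve_length \<gamma> = ereal (d a b)"
      by (simp add: \<gamma>)
    from curve_length_scale_le[OF distS _ this, folded e] r curve_length_nonneg[of "S \<circ> \<gamma>", folded e]
    show ?thesis by simp
  qed
  then show "0 \<le> d (S a) (S b)" "d (S a) (S b) \<le> r * d a b" by auto
qed

text \<open>The repeated letters fix \<open>q (opp i)\<close> and \<open>q i\<close>, which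
  \<open>\<psi> i\<close> and \<open>\<psi> 5\<close> send to one point. Hence both cells are images
  of first-level cells under one common similarity.\<close>

lemma \<psi>w_wedge:
  assumes "i \<in> {1..4}"
  shows "\<psi>w (v @ i # replicate n (opp i)) y =
      \<psi>w v (\<psi> 5 (q i)) + (1/3) ^ (length v + n) *\<^sub>R (\<psi> i y - \<psi> 5 (q i))"
    and "\<psi>w (v @ 5 # replicate n i) y =
      \<psi>w v (\<psi> 5 (q i)) + (1/3) ^ (length v + n) *\<^sub>R (\<psi> 5 y - \<psi> 5 (q i))"
  using \<psi>w_shift[of "v @ i # replicate n (opp i)" y "q (opp i)"]
    \<psi>w_shift[of "v @ 5 # replicate n i" y "q i"]
    \<psi>_shift[of i y "q (opp i)"] \<psi>_shift[of 5 y "q i"] \<psi>_opp[OF assms]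
  by (simp_all add: power_add)

text \<open>The two cells are neighbours at \<open>\<psi>w v (\<psi> 5 (q i))\<close>. The similarity of ratio
  \<open>(1/3) ^ (length v + n)\<close> that maps \<open>\<psi> 5 (q i)\<close> to that point sends \<open>\<psi> i ` vicsek\<close> and
  \<open>\<psi> 5 ` vicsek\<close> onto them, so that the triangle inequality for \<open>d\<close> is not needed.\<close>

lemma geodesic_dist_adjacent_cells:
  assumes d: "is_geodesic_dist d"
    and M: "\<And>a b. a \<in> vicsek \<Longrightarrow> b \<in> vicsek \<Longrightarrow> d a b \<le> M"
    and i: "i \<in> {1..4}" and v: "set v \<subseteq> {1..5}"
    and x: "x \<in> \<psi>w (v @ i # replicate n (opp i)) ` vicsek"
    and y: "y \<in> \<psi>w (v @ 5 # replicate n i) ` vicsek"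
  shows "0 \<le> d x y" "d x y \<le> (1/3) ^ (length v + n) * M"
proof -
  define u where "u = v @ i # replicate n (opp i)"
  define u' where "u' = v @ 5 # replicate n i"
  define r :: real where "r = (1/3) ^ (length v + n)"
  define z where "z = \<psi> 5 (q i)"
  define S where "S = (\<lambda>a. r *\<^sub>R a + (\<psi>w v z - r *\<^sub>R z))"
  define U where "U = (\<Union>n. Vbar n)"
  have u: "set u \<subseteq> {1..5}" "set u' \<subseteq> {1..5}"
    using v i opp_in[OF i] by (auto simp: u_def u'_def)
  have S: "\<psi>w u a = S (\<psi> i a)" "\<psi>w u' a = S (\<psi> 5 a)" for a
    using \<psi>w_wedge[OF i, of v n a]
    by (simp_all add: u_def u'_def S_def r_def z_def algebra_simps)
  \<comment> \<open>Tree points come first, where arcs determine \<open>d\<close>; continuity of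
    \<open>d\<close> and density of \<open>U\<close> then extend both bounds to the whole
    cells.\<close>
  have bound: "0 \<le> d (\<psi>w u a) (\<psi>w u' b) \<and> d (\<psi>w u a) (\<psi>w u' b) \<le> r * M"
    if ab: "a \<in> U" "b \<in> U" for a b
  proof -
    obtain k l where "a \<in> Vbar k" "b \<in> Vbar l" using ab by (auto simp: U_def)
    then obtain m where m: "a \<in> Vbar m" "b \<in> Vbar m"
      using Vbar_mono[of k "max k l"] Vbar_mono[of l "max k l"] by auto
    define X where "X = \<psi> i ` Vbar m \<union> \<psi> 5 ` Vbar m"
    have pc: "path_connected X"
      unfolding X_def
    proof (rule path_connected_wedge[OF path_connected_Vbar i])
      show "q i \<in> Vbar m" using i by (intro q_in_Vbar) auto
      show "q (opp i) \<in> Vbar m" using opp_in[OF i] by (intro q_in_Vbar) auto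
    qed
    have X: "X \<subseteq> Vbar (Suc m)"
      using UN_upper[of i "{1..5}" "\<lambda>i. \<psi> i ` Vbar m"] UN_upper[of 5 "{1..5}" "\<lambda>i. \<psi> i ` Vbar m"] i
      by (simp add: X_def)
    have "S ` X \<subseteq> Vbar (length u + m)"
      using \<psi>w_in_Vbar[OF u(1), of _ m] \<psi>w_in_Vbar[OF u(2), of _ m]
      by (auto simp: X_def simp flip: S simp: u_def u'_def)
    from geodesic_dist_scale_le[OF d _ _ pc X this, of r "\<psi>w v z - r *\<^sub>R z" "\<psi> i a" "\<psi> 5 b"] m
    have 1: "0 \<le> d (\<psi>w u a) (\<psi>w u' b)" "d (\<psi>w u a) (\<psi>w u' b) \<le> r * d (\<psi> i a) (\<psi> 5 b)"
      by (auto simp: S S_def r_def X_def)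
    have "d (\<psi> i a) (\<psi> 5 b) \<le> M"
      using m i by (intro M \<psi>_in_vicsek) (auto intro: Vbar_subset_vicsek[THEN subsetD])
    then have "r * d (\<psi> i a) (\<psi> 5 b) \<le> r * M"
      by (simp add: r_def)
    with 1 show ?thesis by simp
  qed
  have "continuous_on (vicsek \<times> vicsek) (\<lambda>(x, y). d x y)"
    using d unfolding is_geodesic_dist_def by blast
  moreover have "continuous_on (vicsek \<times> vicsek) (\<lambda>p. (\<psi>w u (fst p), \<psi>w u' (snd p)))"
    by (intro continuous_on_Pair continuous_on_compose2[OF continuous_on_\<psi>w[of UNIV]]
        continuous_on_fst continuous_on_snd continuous_on_id) auto
  moreover have "(\<lambda>p. (\<psi>w u (fst p), \<psi>w u' (snd p))) ` (vicsek \<times> vicsek) \<subseteq> vicsek \<times> vicsek"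
    by (intro image_subsetI SigmaI \<psi>w_in_vicsek u) auto
  ultimately have cont: "continuous_on (vicsek \<times> vicsek) (\<lambda>p. d (\<psi>w u (fst p)) (\<psi>w u' (snd p)))"
    using continuous_on_compose2[of "vicsek \<times> vicsek" "\<lambda>(x, y). d x y" "vicsek \<times> vicsek"
        "\<lambda>p. (\<psi>w u (fst p), \<psi>w u' (snd p))"] by simp
  have cl: "closure (U \<times> U) = vicsek \<times> vicsek"
    by (simp add: closure_Times U_def flip: vicsek_eq_closure)
  obtain a b where ab: "(a, b) \<in> vicsek \<times> vicsek" "x = \<psi>w u a" "y = \<psi>w u' b"
    using x y by (auto simp: u_def u'_def)
  show "0 \<le> d x y"
    using continuous_ge_on_closure[OF cont[folded cl], of "(a, b)" 0] bound ab cl by auto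
  show "d x y \<le> (1/3) ^ (length v + n) * M"
    using continuous_le_on_closure[OF cont[folded cl], of "(a, b)" "r * M"] bound ab cl
    by (auto simp: r_def)
qed

section \<open>Words and cells\<close>

definition words :: "nat set \<Rightarrow> nat \<Rightarrow> nat list set" where
  "words A n = {w. set w \<subseteq> A \<and> length w = n}"

abbreviation cell :: "nat list \<Rightarrow> plane set" where
  "cell w \<equiv> \<psi>w w ` vicsek"

lemma finite_words: "finite A \<Longrightarrow> finite (words A n)"
  unfolding words_def by (rule finite_lists_length_eq)

lemma card_words: "finite A \<Longrightarrow> card (words A n) = card A ^ n"
  unfolding words_def by (rule card_lists_length_eq)

lemma cell_append_subset: "set w \<subseteq> {1..5} \<Longrightarrow> cell (v @ w) \<subseteq> cell v"
  using \<psi>w_in_vicsek[of w] by auto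

lemma ex_cell: "x \<in> vicsek \<Longrightarrow> \<exists>w\<in>words {1..5} n. x \<in> cell w"
proof (induction n arbitrary: x)
  case 0
  then show ?case by (auto simp: words_def image_iff)
next
  case (Suc n)
  from Suc.prems obtain i y where i: "i \<in> {1..5}" "y \<in> vicsek" "x = \<psi> i y"
    using vicsek_eq by blast
  from Suc.IH[OF i(2)] obtain w a where "w \<in> words {1..5} n" "a \<in> vicsek" "y = \<psi>w w a"
    by blast
  then show ?case
    using i by (intro bexI[of _ "i # w"]) (auto simp: words_def)
qed

lemma sum_words_Suc:
  fixes G :: "nat list \<Rightarrow> real"
  assumes "finite A"
  shows "(\<Sum>w\<in>words A (Suc n). G w) = (\<Sum>a\<in>A. \<Sum>w\<in>words A n. G (a # w))"
proof -
  have "words A (Suc n) = (\<lambda>(w, a). a # w) ` (words A n \<times> A)"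
    using lists_length_Suc_eq[of A n] by (simp add: words_def)
  then have "(\<Sum>w\<in>words A (Suc n). G w) = (\<Sum>(w, a)\<in>words A n \<times> A. G (a # w))"
    by (simp add: sum.reindex inj_on_def case_prod_unfold)
  also have "\<dots> = (\<Sum>w\<in>words A n. \<Sum>a\<in>A. G (a # w))"
    by (simp add: sum.cartesian_product)
  finally show ?thesis by (simp add: sum.swap[of _ A])
qed

text \<open>The cells of the words over \<open>{opp i, 5, i}\<close> cover the diagonal from \<open>q (opp i)\<close> to
  \<open>q i\<close>; every cell but the two extreme ones occurs in two consecutive pairs.\<close>

lemma diagonal_telescope:
  fixes F G :: "nat list \<Rightarrow> real"
  assumes i: "i \<in> {1..4}"
    and step: "\<And>k v' n'. k \<in> {1..4} \<Longrightarrow> set v' \<subseteq> {1..5} \<Longrightarrow> length v' + Suc n' = m \<Longrightarrow>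
      \<bar>F (v' @ k # replicate n' (opp k)) - F (v' @ 5 # replicate n' k)\<bar>
        \<le> C * (G (v' @ k # replicate n' (opp k)) + G (v' @ 5 # replicate n' k))"
    and v: "set v \<subseteq> {1..5}" "length v + n = m"
  shows "\<bar>F (v @ replicate n (opp i)) - F (v @ replicate n i)\<bar>
    \<le> C * (2 * (\<Sum>w\<in>words {opp i, 5, i} n. G (v @ w))
            - G (v @ replicate n (opp i)) - G (v @ replicate n i))"
  using v
proof (induction n arbitrary: v)
  case 0
  \<comment> \<open>For \<open>n = 0\<close> both ends are the cell \<open>v\<close>, and the
    right-hand side is \<open>C * (2 * G v - G v - G v) = 0\<close>.\<close>
  have "words {opp i, 5, i} 0 = {[]}" by (auto simp: words_def)
  then show ?case by simp
next
  case (Suc n)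
  let ?A = "{opp i, 5, i}"
  let ?T = "\<lambda>a. \<Sum>w\<in>words ?A n. G (v @ a # w)"
  let ?j = "opp i"
  have neq: "?j \<noteq> 5" "?j \<noteq> i" "i \<noteq> 5"
    using i opp_in[OF i] opp_neq[OF i] by auto
  have sum: "(\<Sum>w\<in>words ?A (Suc n). G (v @ w)) = ?T ?j + ?T 5 + ?T i"
    using neq by (subst sum_words_Suc) (auto simp: algebra_simps)
  \<comment> \<open>Each third \<open>a\<close> of the diagonal is handled by induction. The bridges
    \<open>s1\<close> and \<open>s2\<close> join the thirds, and their \<open>G\<close> terms cancel
    the four inner end corrections.\<close>
  have IH: "\<bar>F (v @ a # replicate n ?j) - F (v @ a # replicate n i)\<bar>
      \<le> C * (2 * ?T a - G (v @ a # replicate n ?j) - G (v @ a # replicate n i))" if "a \<in> ?A" for a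
    using Suc.IH[of "v @ [a]"] Suc.prems that i opp_in[OF i] by auto
  have s1: "\<bar>F (v @ ?j # replicate n i) - F (v @ 5 # replicate n ?j)\<bar>
      \<le> C * (G (v @ ?j # replicate n i) + G (v @ 5 # replicate n ?j))"
    using step[OF opp_in[OF i] Suc.prems] by (simp add: opp_opp[OF i])
  have s2: "\<bar>F (v @ i # replicate n ?j) - F (v @ 5 # replicate n i)\<bar>
      \<le> C * (G (v @ i # replicate n ?j) + G (v @ 5 # replicate n i))"
    using step[OF i Suc.prems] .
  show ?case
    using IH[of ?j] IH[of 5] IH[of i] s1 s2 unfolding sum replicate_Suc
    by (simp add: algebra_simps)
qed

text \<open>If \<open>a > e\<close>, then \<open>(a / e) powr (p - 1)\<close> is at least
  \<open>1\<close>. The parameter \<open>e\<close> stays free until the chain estimate is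
  complete.\<close>

lemma le_add_powr:
  fixes a e p :: real
  assumes "0 \<le> a" "0 < e" "1 < p"
  shows "a \<le> e + e powr (1 - p) * a powr p"
proof (cases "a \<le> e")
  case True
  then show ?thesis by (simp add: add_increasing2)
next
  case False
  then have "a = a powr (1 - p) * a powr p"
    using assms by (simp flip: powr_add)
  also have "\<dots> \<le> e powr (1 - p) * a powr p"
    using False assms by (intro mult_right_mono powr_mono2') auto
  finally show ?thesis using assms by simp
qed

text \<open>This holds because \<open>3 powr d\<^sub>h = 5\<close>. The factor
  \<open>(1/3) ^ m\<close> offsets the number of cells in a chain; the \<open>p\<close>-th power of
  the other factor, times the \<open>5 ^ m\<close> from averaging over a cell, is
  \<open>3 ^ m\<close>.\<close>

lemma one_third_powr_\<alpha>:
  assumes "1 < p"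
  shows "((1/3) ^ m) powr \<alpha> p = (1/3) ^ m * ((3/5) ^ m) powr (1/p)"
proof -
  have "((1/3::real) ^ m) powr \<alpha> p = exp (- (\<alpha> p * (real m * ln 3)))"
    by (simp add: powr_def ln_realpow ln_div)
  also have "\<alpha> p * (real m * ln 3) = real m * ln 3 - (1/p) * (real m * (ln 3 - ln 5))"
    using assms by (simp add: \<alpha>_def d\<^sub>h_def field_simps)
  also have "exp (- \<dots>) = exp (- (real m * ln 3)) * exp ((1/p) * (real m * (ln 3 - ln 5)))"
    by (simp flip: exp_add)
  also have "exp ((1/p) * (real m * (ln 3 - ln 5))) = ((3/5) ^ m) powr (1/p)"
    by (simp add: powr_def ln_realpow ln_div)
  also have "exp (- (real m * ln 3)) = (1/3::real) ^ m"
    using exp_of_nat_mult[of m "- ln (3::real)"] by (simp add: exp_minus power_one_over inverse_eq_divide)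
  finally show ?thesis .
qed

section \<open>The self-similar measure\<close>

context
  fixes \<mu> :: "plane measure"
  assumes \<mu>: "is_vicsek_measure \<mu>"
begin

interpretation prob_space \<mu>
  using \<mu> by (simp add: is_vicsek_measure_def)

lemma space_vicsek_measure: "space \<mu> = vicsek"
proof -
  have "sets \<mu> = sets (restrict_space borel vicsek)"
    using \<mu> by (simp add: is_vicsek_measure_def)
  from sets_eq_imp_space_eq[OF this] show ?thesis
    by (simp add: space_restrict_space)
qed

lemma cell_measurable: "set w \<subseteq> {1..5} \<Longrightarrow> cell w \<in> sets \<mu>"
proof -
  assume w: "set w \<subseteq> {1..5}"
  have "compact (cell w)"
    by (rule compact_continuous_image[OF continuous_on_\<psi>w compact_vicsek])
  moreover have "cell w = vicsek \<inter> cell w"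
    using cell_append_subset[of w "[]"] w by auto
  moreover have "sets \<mu> = (\<inter>) vicsek ` sets borel"
    using \<mu> by (simp add: is_vicsek_measure_def sets_restrict_space)
  ultimately show ?thesis
    by (metis borel_compact imageI)
qed

lemma measure_cell: "set w \<subseteq> {1..5} \<Longrightarrow> measure \<mu> (cell w) = 1 / 5 ^ length w"
  using \<mu> by (simp add: is_vicsek_measure_def)

text \<open>The indicators of the cells of level \<open>n\<close> add up to at least \<open>1\<close> everywhere and to \<open>1\<close>
  on average, so the cells overlap in null sets only.\<close>

lemma AE_sum_indicator_cells:
  "AE x in \<mu>. (\<Sum>w\<in>words {1..5} n. indicator (cell w) x) = (1::real)"
proof -
  let ?s = "\<lambda>x. \<Sum>w\<in>words {1..5} n. indicator (cell w) x :: real"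
  have int: "integrable \<mu> (indicator (cell w) :: plane \<Rightarrow> real)" if "w \<in> words {1..5} n" for w
    using that by (intro integrable_real_indicator cell_measurable)
      (auto simp: words_def emeasure_eq_measure)
  then have int_s: "integrable \<mu> ?s"
    by (rule Bochner_Integration.integrable_sum)
  have "(\<integral>x. ?s x \<partial>\<mu>) = (\<Sum>w\<in>words {1..5} n. \<integral>x. indicator (cell w) x \<partial>\<mu>)"
    using int by (rule Bochner_Integration.integral_sum)
  also have "\<dots> = (\<Sum>w\<in>words {1..5} n. 1 / 5 ^ n)"
  proof (rule sum.cong)
    fix w assume "w \<in> words {1..5} n"
    then have w: "set w \<subseteq> {1..5}" "length w = n" by (auto simp: words_def)
    have "cell w \<inter> space \<mu> = cell w"
      using sets.sets_into_space[OF cell_measurable[OF w(1)]] by blast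
    then show "(\<integral>x. indicator (cell w) x \<partial>\<mu>) = (1 / 5 ^ n :: real)"
      using measure_cell[OF w(1)] w(2) by simp
  qed simp
  also have "\<dots> = 1"
    by (simp add: card_words)
  finally have "(\<integral>x. ?s x \<partial>\<mu>) = 1" .
  with Bochner_Integration.integral_diff[OF int_s integrable_const[of 1]]
  have 1: "(\<integral>x. ?s x - 1 \<partial>\<mu>) = 0"
    by (simp only: lebesgue_integral_const prob_space) simp
  have "0 \<le> ?s x - 1" if x: "x \<in> space \<mu>" for x
  proof -
    obtain w where w: "w \<in> words {1..5} n" "x \<in> cell w"
      using x ex_cell unfolding space_vicsek_measure by blast
    have "indicator (cell w) x \<le> ?s x"
      by (rule member_le_sum[OF w(1)]) (auto intro: finite_words)
    with w show ?thesis by simp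
  qed
  then have "AE x in \<mu>. 0 \<le> ?s x - 1"
    by (rule AE_I2)
  from integral_nonneg_eq_0_iff_AE[OF Bochner_Integration.integrable_diff[OF int_s integrable_const[of 1]] this] 1
  have "AE x in \<mu>. ?s x - 1 = 0"
    by blast
  then show ?thesis by simp
qed

section \<open>Integrals and averages over cells\<close>

lemma integrable_indicator_cell:
  fixes h :: "plane \<Rightarrow> real"
  assumes "integrable \<mu> h" "set w \<subseteq> {1..5}"
  shows "integrable \<mu> (\<lambda>x. indicator (cell w) x * h x)"
  using integrable_mult_indicator[OF cell_measurable[OF assms(2)] assms(1)] by simp

text \<open>Almost every point lies in exactly one cell of level \<open>n\<close>, hence in at most
  one from \<open>W\<close>.\<close>

lemma sum_integral_cells_le:
  fixes h :: "plane \<Rightarrow> real"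
  assumes h: "integrable \<mu> h" "\<And>x. 0 \<le> h x" and W: "W \<subseteq> words {1..5} n"
  shows "(\<Sum>w\<in>W. \<integral>x. indicator (cell w) x * h x \<partial>\<mu>)
    \<le> (\<integral>x. indicator (\<Union>w\<in>W. cell w) x * h x \<partial>\<mu>)"
proof -
  have fin: "finite W"
    using finite_subset[OF W finite_words] by simp
  have W': "set w \<subseteq> {1..5}" if "w \<in> W" for w
    using that W by (auto simp: words_def)
  have meas: "(\<Union>w\<in>W. cell w) \<in> sets \<mu>"
    using fin W' cell_measurable by blast
  have "(\<Sum>w\<in>W. \<integral>x. indicator (cell w) x * h x \<partial>\<mu>)
      = (\<integral>x. (\<Sum>w\<in>W. indicator (cell w) x * h x) \<partial>\<mu>)"
    using W' h by (intro Bochner_Integration.integral_sum[symmetric] integrable_indicator_cell)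
  also have "\<dots> \<le> (\<integral>x. indicator (\<Union>w\<in>W. cell w) x * h x \<partial>\<mu>)"
  proof (rule integral_mono_AE)
    show "integrable \<mu> (\<lambda>x. \<Sum>w\<in>W. indicator (cell w) x * h x)"
      using W' h by (intro Bochner_Integration.integrable_sum integrable_indicator_cell)
    show "integrable \<mu> (\<lambda>x. indicator (\<Union>w\<in>W. cell w) x * h x)"
      using integrable_mult_indicator[OF meas h(1)] by simp
    show "AE x in \<mu>. (\<Sum>w\<in>W. indicator (cell w) x * h x) \<le> indicator (\<Union>w\<in>W. cell w) x * h x"
      using AE_sum_indicator_cells[of n]
    proof eventually_elim
      case (elim x)
      have "(\<Sum>w\<in>W. indicator (cell w) x) \<le> (indicator (\<Union>w\<in>W. cell w) x :: real)"
      proof (cases "x \<in> (\<Union>w\<in>W. cell w)")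
        case True
        have "(\<Sum>w\<in>W. indicator (cell w) x) \<le> (\<Sum>w\<in>words {1..5} n. indicator (cell w) x :: real)"
          by (intro sum_mono2 finite_words W) auto
        with True elim show ?thesis by simp
      next
        case False
        then show ?thesis by simp
      qed
      then show ?case
        using h(2)[of x] by (simp add: mult_right_mono flip: sum_distrib_right)
    qed
  qed
  finally show ?thesis .
qed

text \<open>Otherwise \<open>h\<close> exceeds its average \<open>?c\<close> on the cell off
  \<open>N\<close>. Then \<open>?k\<close> is nonnegative a.e. with integral \<open>0\<close>, so it
  vanishes a.e. and the cell is null, against \<open>measure_cell\<close>.\<close>

lemma ex_point_in_cell_le_average:
  fixes h :: "plane \<Rightarrow> real"
  assumes h: "integrable \<mu> h" and N: "N \<in> null_sets \<mu>" and w: "set w \<subseteq> {1..5}"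
  shows "\<exists>x\<in>cell w - N. h x \<le> 5 ^ length w * (\<integral>x. indicator (cell w) x * h x \<partial>\<mu>)"
proof (rule ccontr)
  let ?I = "\<integral>x. indicator (cell w) x * h x \<partial>\<mu>"
  let ?c = "5 ^ length w * ?I"
  let ?k = "\<lambda>x. indicator (cell w) x * h x - ?c * indicator (cell w) x"
  assume "\<not> ?thesis"
  then have gt: "?c < h x" if "x \<in> cell w - N" for x
    using that by force
  have cell: "cell w \<inter> space \<mu> = cell w"
    using sets.sets_into_space[OF cell_measurable[OF w]] by blast
  have int: "integrable \<mu> (indicator (cell w) :: plane \<Rightarrow> real)"
    by (intro integrable_real_indicator cell_measurable w) (auto simp: emeasure_eq_measure)
  have intk: "integrable \<mu> ?k"
    using int integrable_indicator_cell[OF h w] by auto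
  have "(\<integral>x. ?k x \<partial>\<mu>) = ?I - ?c * measure \<mu> (cell w)"
    using int integrable_indicator_cell[OF h w] cell by simp
  also have "\<dots> = 0"
    by (simp add: measure_cell[OF w])
  finally have 0: "(\<integral>x. ?k x \<partial>\<mu>) = 0" .
  have "AE x in \<mu>. 0 \<le> ?k x"
    using AE_not_in[OF N]
  proof eventually_elim
    case (elim x)
    then show ?case using gt[of x] by (cases "x \<in> cell w") auto
  qed
  with 0 intk have "AE x in \<mu>. ?k x = 0"
    by (simp add: integral_nonneg_eq_0_iff_AE)
  then have "AE x in \<mu>. x \<notin> cell w"
    using AE_not_in[OF N]
  proof eventually_elim
    case (elim x)
    then show ?case using gt[of x] by (cases "x \<in> cell w") auto
  qed
  then have "emeasure \<mu> (cell w) = 0"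
    using AE_iff_null_sets[OF cell_measurable[OF w]] by auto
  then have "measure \<mu> (cell w) = 0"
    by (simp add: measure_def)
  then show False
    by (simp add: measure_cell[OF w])
qed

text \<open>The sets decrease and have measure at most \<open>(card A / 5) ^ n\<close>, so their
  intersection is null and dominated convergence applies.\<close>

lemma integral_cells_tendsto_0:
  fixes h :: "plane \<Rightarrow> real"
  assumes h: "integrable \<mu> h" and A: "A \<subseteq> {1..5}" "card A < 5" and v: "set v \<subseteq> {1..5}"
  shows "(\<lambda>n. \<integral>x. indicator (\<Union>w\<in>words A n. cell (v @ w)) x * h x \<partial>\<mu>) \<longlonglongrightarrow> 0"
proof -
  define D where "D n = (\<Union>w\<in>words A n. cell (v @ w))" for n
  have fin: "finite A" using A finite_subset by blast
  have W: "set (v @ w) \<subseteq> {1..5}" "length (v @ w) = length v + n" if "w \<in> words A n" for w n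
    using that A(1) v by (auto simp: words_def)
  have meas: "D n \<in> sets \<mu>" for n
    unfolding D_def using finite_words[OF fin] W cell_measurable by blast
  have decr: "D (Suc n) \<subseteq> D n" for n
  proof
    fix x assume "x \<in> D (Suc n)"
    then obtain w where w: "w \<in> words A (Suc n)" "x \<in> cell (v @ w)"
      by (auto simp: D_def)
    \<comment> \<open>Dropping the last letter of a word gives a larger cell.\<close>
    then obtain w' a where w': "w = w' @ [a]" "w' \<in> words A n" "a \<in> A"
      by (cases w rule: rev_cases) (auto simp: words_def)
    have "set [a] \<subseteq> {1..5}" using w' A by auto
    from cell_append_subset[OF this, of "v @ w'"] have "x \<in> cell (v @ w')"
      using w(2) unfolding w'(1) append_assoc by blast
    with w'(2) show "x \<in> D n"
      unfolding D_def by blast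
  qed
  have "measure \<mu> (D n) \<le> (card A / 5) ^ n" for n
  proof -
    have "measure \<mu> (D n) \<le> (\<Sum>w\<in>words A n. measure \<mu> (cell (v @ w)))"
      unfolding D_def using W
      by (intro finite_measure_subadditive_finite finite_words[OF fin] image_subsetI cell_measurable)
    also have "\<dots> = (\<Sum>w\<in>words A n. 1 / 5 ^ (length v + n))"
      using W measure_cell by (intro sum.cong) metis+
    also have "\<dots> = (card A / 5) ^ n / 5 ^ length v"
      by (simp add: card_words[OF fin] power_add power_divide)
    also have "\<dots> \<le> (card A / 5) ^ n"
      using mult_left_mono[of 1 "5 ^ length v :: real" "(card A / 5) ^ n"] by (simp add: divide_le_eq)
    finally show ?thesis .
  qed
  moreover have "(\<lambda>n. (card A / 5) ^ n) \<longlonglongrightarrow> 0"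
    using A(2) by (intro LIMSEQ_power_zero) simp
  ultimately have "(\<lambda>n. measure \<mu> (D n)) \<longlonglongrightarrow> 0"
    by (intro Lim_null_comparison[of "\<lambda>n. measure \<mu> (D n)"]) simp_all
  moreover have "(\<lambda>n. measure \<mu> (D n)) \<longlonglongrightarrow> measure \<mu> (\<Inter>n. D n)"
    using meas decr by (intro finite_Lim_measure_decseq) (auto intro: decseq_SucI)
  ultimately have "measure \<mu> (\<Inter>n. D n) = 0"
    using LIMSEQ_unique by blast
  then have "(\<Inter>n. D n) \<in> null_sets \<mu>"
    using meas by (auto simp: null_sets_def emeasure_eq_measure)
  then have AE: "AE x in \<mu>. x \<notin> (\<Inter>n. D n)"
    by (rule AE_not_in)
  have "(\<lambda>n. \<integral>x. indicator (D n) x * h x \<partial>\<mu>) \<longlonglongrightarrow> (\<integral>x. 0 \<partial>\<mu>)"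
  proof (rule integral_dominated_convergence[where w = "\<lambda>x. \<bar>h x\<bar>"])
    show "AE x in \<mu>. (\<lambda>n. indicator (D n) x * h x) \<longlonglongrightarrow> 0"
      using AE
    proof eventually_elim
      case (elim x)
      then obtain n where n: "x \<notin> D n" by blast
      have "x \<notin> D k" if "k \<ge> n" for k
        using lift_Suc_antimono_le[of D, OF decr that] n by blast
      then have "\<forall>\<^sub>F k in sequentially. indicator (D k) x * h x = 0"
        by (auto intro: eventually_sequentiallyI[of n])
      then show ?case by (rule tendsto_eventually)
    qed
  qed (use h meas in \<open>auto simp: indicator_def\<close>)
  then show ?thesis by (simp add: D_def)
qed

end

section \<open>Equality at opposite corners\<close>

text \<open>The cell of \<open>v @ w n\<close> contains \<open>\<psi>w v a\<close>, as
  \<open>w n\<close> fixes \<open>a\<close>, and its diameter is at most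
  \<open>2 * (1/3) ^ n\<close>.\<close>

lemma \<psi>w_sequence_tendsto:
  assumes "\<And>n. X n \<in> cell (v @ w n)" "\<And>n. length (w n) = n" "\<And>n. \<psi>w (w n) a = a" "a \<in> vicsek"
  shows "X \<longlonglongrightarrow> \<psi>w v a"
proof (rule tendsto_dist_iff[THEN iffD2])
  have "dist (X n) (\<psi>w v a) \<le> 2 * (1/3) ^ n" for n
  proof -
    obtain b where b: "b \<in> vicsek" "X n = \<psi>w (v @ w n) b"
      using assms(1)[of n] by blast
    have "dist (X n) (\<psi>w v a) = dist (\<psi>w (v @ w n) b) (\<psi>w (v @ w n) a)"
      by (simp add: b assms(3))
    also have "\<dots> = (1/3) ^ (length v + n) * dist b a"
      by (simp add: dist_\<psi>w assms(2) del: \<psi>w_append)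
    also have "dist b a \<le> norm b + norm a"
      unfolding dist_norm by (rule norm_triangle_ineq4)
    also have "\<dots> \<le> 2"
      using norm_vicsek_le[OF b(1)] norm_vicsek_le[OF assms(4)] by simp
    also have "(1/3) ^ (length v + n) * 2 \<le> 2 * (1/3::real) ^ n"
      by (simp add: power_add mult_left_le_one_le power_le_one)
    finally show ?thesis by simp
  qed
  moreover have "(\<lambda>n. 2 * (1/3::real) ^ n) \<longlonglongrightarrow> 0"
    by (intro tendsto_mult_right_zero LIMSEQ_power_zero) simp
  ultimately show "(\<lambda>n. dist (X n) (\<psi>w v a)) \<longlonglongrightarrow> 0"
    by (intro Lim_null_comparison[of "\<lambda>n. dist (X n) (\<psi>w v a)" "\<lambda>n. 2 * (1/3) ^ n"]) simp_all
qed

lemma continuous_on_vicsek_sequentially: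
  fixes f :: "plane \<Rightarrow> real"
  assumes "continuous_on vicsek f" "X \<longlonglongrightarrow> x" "\<And>n. X n \<in> vicsek"
  shows "(\<lambda>n. f (X n)) \<longlonglongrightarrow> f x"
proof -
  have "x \<in> vicsek"
    using closed_sequentially[OF compact_imp_closed[OF compact_vicsek]] assms by blast
  then show ?thesis
    using assms by (auto intro!: continuous_on_tendsto_compose[OF assms(1)])
qed

lemma Hajlasz_diagonal_eq:
  fixes f :: "plane \<Rightarrow> real"
  assumes p: "1 < p"
    and d: "is_geodesic_dist d"
    and \<mu>: "is_vicsek_measure \<mu>"
    and f: "continuous_on vicsek f"
    and g: "Lp_fun p \<mu> g" and N: "N \<in> null_sets \<mu>"
    and fg: "\<And>x y. x \<in> vicsek - N \<Longrightarrow> y \<in> vicsek - N \<Longrightarrow>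
      \<bar>f x - f y\<bar> \<le> d x y powr \<alpha> p * (g x + g y)"
    and i: "i \<in> {1..4}" and v: "set v \<subseteq> {1..5}"
  shows "f (\<psi>w v (q (opp i))) = f (\<psi>w v (q i))"
proof -
  define h where "h x = \<bar>g x\<bar> powr p" for x
  have h: "integrable \<mu> h" "\<And>x. 0 \<le> h x"
    using g by (auto simp: Lp_fun_def h_def[abs_def])
  define A where "A = {opp i, 5, i}"
  have A: "A \<subseteq> {1..5}" "card A = 3" "finite A"
    using i opp_in[OF i] opp_neq[OF i] by (auto simp: A_def)
  define D where "D n = (\<Union>w\<in>words A n. cell (v @ w))" for n
  have "\<forall>w. \<exists>x. set w \<subseteq> {1..5} \<longrightarrow> x \<in> cell w - N \<and>
      h x \<le> 5 ^ length w * (\<integral>x. indicator (cell w) x * h x \<partial>\<mu>)"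
    using ex_point_in_cell_le_average[OF \<mu> h(1) N] by metis
  then obtain X where X: "\<And>w. set w \<subseteq> {1..5} \<Longrightarrow> X w \<in> cell w - N"
      "\<And>w. set w \<subseteq> {1..5} \<Longrightarrow> h (X w) \<le> 5 ^ length w * (\<integral>x. indicator (cell w) x * h x \<partial>\<mu>)"
    by metis
  have X_vicsek: "X w \<in> vicsek - N" if "set w \<subseteq> {1..5}" for w
    using X(1)[OF that] cell_append_subset[OF that, of "[]"] by auto
  \<comment> \<open>\<open>g\<close> may take either sign; the absolute value makes the weights of
    the chain nonnegative.\<close>
  define G where "G w = \<bar>g (X w)\<bar>" for w
  have "continuous_on (vicsek \<times> vicsek) (\<lambda>(x, y). d x y)"
    using d unfolding is_geodesic_dist_def by blast
  then have "bounded ((\<lambda>(x, y). d x y) ` (vicsek \<times> vicsek))"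
    by (intro compact_imp_bounded compact_continuous_image compact_Times compact_vicsek)
  then obtain M where M: "0 < M" "\<And>a b. a \<in> vicsek \<Longrightarrow> b \<in> vicsek \<Longrightarrow> d a b \<le> M"
    unfolding bounded_pos by fastforce
  \<comment> \<open>Neighbouring cells of level \<open>m\<close> have a common parent-scale bound
    \<open>(1/3) ^ (m - 1) * M\<close>, which accounts for the factor \<open>3\<close>.\<close>
  define C where "C = (3 * M) powr \<alpha> p"
  \<comment> \<open>A nonnegative exponent makes \<open>powr\<close> monotone on the nonnegative
    values of \<open>d\<close> that occur.\<close>
  have \<alpha>: "0 \<le> \<alpha> p"
    using p by (simp add: \<alpha>_def d\<^sub>h_def divide_simps)
  define r where "r m = ((1/3) ^ m) powr \<alpha> p" for m :: nat
  have step: "\<bar>f (X (v' @ k # replicate n' (opp k))) - f (X (v' @ 5 # replicate n' k))\<bar>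
      \<le> (C * r m) * (G (v' @ k # replicate n' (opp k)) + G (v' @ 5 # replicate n' k))"
    if k: "k \<in> {1..4}" and v': "set v' \<subseteq> {1..5}" and m: "length v' + Suc n' = m" for k v' n' m
  proof -
    let ?u = "v' @ k # replicate n' (opp k)" and ?u' = "v' @ 5 # replicate n' k"
    have u: "set ?u \<subseteq> {1..5}" "set ?u' \<subseteq> {1..5}"
      using k v' opp_in[OF k] by auto
    have "X ?u \<in> cell ?u" "X ?u' \<in> cell ?u'"
      using X(1)[OF u(1)] X(1)[OF u(2)] by blast+
    note dist = geodesic_dist_adjacent_cells[OF d M(2) k v' this]
    have "(1/3) ^ (length v' + n') * M = 3 * M * (1/3) ^ m"
      by (simp flip: m)
    with dist(2) have "d (X ?u) (X ?u') \<le> 3 * M * (1/3) ^ m"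
      by simp
    with dist(1) \<alpha> have le: "d (X ?u) (X ?u') powr \<alpha> p \<le> C * r m"
      using M(1) by (auto simp: C_def r_def powr_mono2 simp flip: powr_mult)
    have "\<bar>f (X ?u) - f (X ?u')\<bar> \<le> d (X ?u) (X ?u') powr \<alpha> p * (g (X ?u) + g (X ?u'))"
      by (intro fg X_vicsek u)
    also have "\<dots> \<le> d (X ?u) (X ?u') powr \<alpha> p * (G ?u + G ?u')"
      by (intro mult_left_mono) (auto simp: G_def)
    also have "\<dots> \<le> (C * r m) * (G ?u + G ?u')"
      by (intro mult_right_mono le) (auto simp: G_def)
    finally show ?thesis .
  qed
  have bound: "\<bar>f (X (v @ replicate n (opp i))) - f (X (v @ replicate n i))\<bar>
      \<le> 2 * C * (e + e powr (1 - p) * (\<integral>x. indicator (D n) x * h x \<partial>\<mu>))" if e: "0 < e" for n e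
  proof -
    define m where "m = length v + n"
    \<comment> \<open>Chosen so that \<open>r m = (1/3) ^ m * s powr (1/p)\<close> and
      \<open>s * 5 ^ m = 3 ^ m\<close>.\<close>
    define s :: real where "s = (3/5) ^ m"
    have w: "set (v @ w) \<subseteq> {1..5}" "length (v @ w) = m" if "w \<in> words A n" for w
      using that v A by (auto simp: words_def m_def)
    have Cr: "0 \<le> C * r m"
      by (simp add: C_def r_def)
    have "\<bar>f (X (v @ replicate n (opp i))) - f (X (v @ replicate n i))\<bar>
        \<le> (C * r m) * (2 * (\<Sum>w\<in>words A n. G (v @ w))
            - G (v @ replicate n (opp i)) - G (v @ replicate n i))"
      unfolding A_def
      by (rule diagonal_telescope[where F = "\<lambda>w. f (X w)", OF i step v]) (auto simp: m_def)
    \<comment> \<open>The end corrections, which made the telescoping exact, are now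
      dropped.\<close>
    also have "\<dots> \<le> (C * r m) * (2 * (\<Sum>w\<in>words A n. G (v @ w)))"
      by (rule mult_left_mono[OF _ Cr]) (simp add: G_def)
    also have "\<dots> = 2 * C * ((1/3) ^ m * (\<Sum>w\<in>words A n. s powr (1/p) * G (v @ w)))"
      by (simp add: r_def one_third_powr_\<alpha>[OF p] s_def flip: sum_distrib_left)
    finally have 1: "\<bar>f (X (v @ replicate n (opp i))) - f (X (v @ replicate n i))\<bar> \<le> \<dots>" .
    have "(\<Sum>w\<in>words A n. s powr (1/p) * G (v @ w))
        \<le> (\<Sum>w\<in>words A n. e + e powr (1 - p) * (3 ^ m * (\<integral>x. indicator (cell (v @ w)) x * h x \<partial>\<mu>)))"
    proof (rule sum_mono)
      fix w assume "w \<in> words A n"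
      note w = w[OF this]
      have "s powr (1/p) * G (v @ w) \<le> e + e powr (1 - p) * (s powr (1/p) * G (v @ w)) powr p"
        by (intro le_add_powr e p) (simp add: G_def)
      also have "(s powr (1/p) * G (v @ w)) powr p = s * h (X (v @ w))"
        using p by (simp add: powr_mult powr_powr G_def h_def s_def)
      also have "\<dots> \<le> s * (5 ^ m * (\<integral>x. indicator (cell (v @ w)) x * h x \<partial>\<mu>))"
        using X(2)[OF w(1)] unfolding w(2) by (intro mult_left_mono) (simp_all add: s_def)
      also have "\<dots> = 3 ^ m * (\<integral>x. indicator (cell (v @ w)) x * h x \<partial>\<mu>)"
        by (simp add: s_def power_divide)
      finally show "s powr (1/p) * G (v @ w)
          \<le> e + e powr (1 - p) * (3 ^ m * (\<integral>x. indicator (cell (v @ w)) x * h x \<partial>\<mu>))"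
        by (simp add: mult_left_mono)
    qed
    also have "\<dots> = 3 ^ n * e + e powr (1 - p) * (3 ^ m *
        (\<Sum>w\<in>words A n. \<integral>x. indicator (cell (v @ w)) x * h x \<partial>\<mu>))"
      by (simp add: sum.distrib card_words A flip: sum_distrib_left)
    \<comment> \<open>Enlarging the number \<open>3 ^ n\<close> of words to \<open>3 ^ m\<close>
      lets the prefactor \<open>(1/3) ^ m\<close> cancel in both terms.\<close>
    also have "\<dots> \<le> 3 ^ m * e + e powr (1 - p) * (3 ^ m * (\<integral>x. indicator (D n) x * h x \<partial>\<mu>))"
    proof (intro add_mono mult_left_mono mult_right_mono)
      show "(3::real) ^ n \<le> 3 ^ m" by (simp add: m_def)
      have "(@) v ` words A n \<subseteq> words {1..5} m"
      proof (rule image_subsetI)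
        show "v @ w \<in> words {1..5} m" if "w \<in> words A n" for w
          unfolding words_def using w[OF that] by blast
      qed
      from sum_integral_cells_le[OF \<mu> h this]
      show "(\<Sum>w\<in>words A n. \<integral>x. indicator (cell (v @ w)) x * h x \<partial>\<mu>)
          \<le> (\<integral>x. indicator (D n) x * h x \<partial>\<mu>)"
        by (simp add: sum.reindex inj_on_def D_def del: \<psi>w_append)
    qed (use e in auto)
    also have "\<dots> = 3 ^ m * (e + e powr (1 - p) * (\<integral>x. indicator (D n) x * h x \<partial>\<mu>))"
      by (simp add: algebra_simps)
    finally have "(1/3) ^ m * (\<Sum>w\<in>words A n. s powr (1/p) * G (v @ w))
        \<le> e + e powr (1 - p) * (\<integral>x. indicator (D n) x * h x \<partial>\<mu>)"
      by (simp add: power_divide divide_le_eq mult.commute)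
    then show ?thesis
      using order_trans[OF 1 mult_left_mono] by (simp add: C_def)
  qed
  have lim_f: "(\<lambda>n. f (X (v @ replicate n k))) \<longlonglongrightarrow> f (\<psi>w v (q k))" if "k \<in> {1..5}" for k
  proof -
    have w: "set (v @ replicate n k) \<subseteq> {1..5}" for n using v that by auto
    show ?thesis
    proof (rule continuous_on_vicsek_sequentially[OF f])
      show "(\<lambda>n. X (v @ replicate n k)) \<longlonglongrightarrow> \<psi>w v (q k)"
        using X(1)[OF w] q_in_vicsek[OF that]
        by (intro \<psi>w_sequence_tendsto[where w = "\<lambda>n. replicate n k"]) auto
      show "X (v @ replicate n k) \<in> vicsek" for n
        using X_vicsek[OF w] by blast
    qed
  qed
  have lim_D: "(\<lambda>n. \<integral>x. indicator (D n) x * h x \<partial>\<mu>) \<longlonglongrightarrow> 0"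
    unfolding D_def by (rule integral_cells_tendsto_0[OF \<mu> h(1) A(1) _ v]) (simp add: A)
  \<comment> \<open>With \<open>e\<close> fixed, \<open>n\<close> tends to infinity first and
    removes the integral, however large \<open>e powr (1 - p)\<close> is; only then does
    \<open>e\<close> become small.\<close>
  have le: "\<bar>f (\<psi>w v (q (opp i))) - f (\<psi>w v (q i))\<bar> \<le> 2 * C * e" if e: "0 < e" for e
  proof (rule LIMSEQ_le)
    show "(\<lambda>n. \<bar>f (X (v @ replicate n (opp i))) - f (X (v @ replicate n i))\<bar>)
        \<longlonglongrightarrow> \<bar>f (\<psi>w v (q (opp i))) - f (\<psi>w v (q i))\<bar>"
      using i opp_in[OF i] by (intro tendsto_intros lim_f) auto
    have "(\<lambda>n. 2 * C * (e + e powr (1 - p) * (\<integral>x. indicator (D n) x * h x \<partial>\<mu>)))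
        \<longlonglongrightarrow> 2 * C * (e + e powr (1 - p) * 0)"
      by (intro tendsto_intros lim_D)
    then show "(\<lambda>n. 2 * C * (e + e powr (1 - p) * (\<integral>x. indicator (D n) x * h x \<partial>\<mu>)))
        \<longlonglongrightarrow> 2 * C * e"
      by simp
  qed (use bound[OF e] in blast)
  have "C > 0" using M by (simp add: C_def)
  have "\<bar>f (\<psi>w v (q (opp i))) - f (\<psi>w v (q i))\<bar> \<le> 0"
  proof (rule field_le_epsilon)
    fix e :: real assume "0 < e"
    with le[of "e / (2 * C)"] \<open>C > 0\<close>
    show "\<bar>f (\<psi>w v (q (opp i))) - f (\<psi>w v (q i))\<bar> \<le> 0 + e" by simp
  qed
  then show ?thesis by simp
qed

section \<open>From equality at opposite corners to constancy\<close>

lemma constant_on_vicsek_if_diagonal_eq: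
  fixes f :: "plane \<Rightarrow> real"
  assumes f: "continuous_on vicsek f"
    and eq: "\<And>i v. i \<in> {1..4} \<Longrightarrow> set v \<subseteq> {1..5} \<Longrightarrow> f (\<psi>w v (q (opp i))) = f (\<psi>w v (q i))"
  shows "f constant_on vicsek"
proof -
  \<comment> \<open>In the subcell \<open>v @ [i]\<close>, one end of the diagonal is the corner
    \<open>i\<close> of cell \<open>v\<close>, the other the corner \<open>i\<close> of the central
    subcell.\<close>
  have shrink: "f (\<psi>w v (q i)) = f (\<psi>w (v @ [5]) (q i))"
    if i: "i \<in> {1..4}" and v: "set v \<subseteq> {1..5}" for i v
    using eq[OF i, of "v @ [i]"] v i by (simp add: \<psi>_opp[OF i])
  \<comment> \<open>Iterating \<open>shrink\<close> gives a constant sequence of values at corners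
    that converge to the centre.\<close>
  have corner: "f (\<psi>w v (q i)) = f (\<psi>w v 0)" if i: "i \<in> {1..4}" and v: "set v \<subseteq> {1..5}" for i v
  proof (rule LIMSEQ_unique)
    have w: "set (v @ replicate n 5) \<subseteq> {1..5}" for n using v by auto
    have q: "q i \<in> vicsek" using i by (intro q_in_vicsek) auto
    have "f (\<psi>w (v @ replicate n 5) (q i)) = f (\<psi>w v (q i))" for n
    proof (induction n)
      case (Suc n)
      have "v @ replicate (Suc n) 5 = (v @ replicate n 5) @ [5]"
        by (simp add: replicate_append_same)
      then show ?case
        using Suc shrink[OF i w[of n]] by simp
    qed simp
    then show "(\<lambda>n. f (\<psi>w (v @ replicate n 5) (q i))) \<longlonglongrightarrow> f (\<psi>w v (q i))"
      by simp
    show "(\<lambda>n. f (\<psi>w (v @ replicate n 5) (q i))) \<longlonglongrightarrow> f (\<psi>w v 0)"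
    proof (rule continuous_on_vicsek_sequentially[OF f])
      show "(\<lambda>n. \<psi>w (v @ replicate n 5) (q i)) \<longlonglongrightarrow> \<psi>w v 0"
        using q q_in_vicsek[of 5] \<psi>w_replicate_q[of _ 5]
        by (intro \<psi>w_sequence_tendsto[where w = "\<lambda>n. replicate n 5"]) auto
      show "\<psi>w (v @ replicate n 5) (q i) \<in> vicsek" for n
        by (rule \<psi>w_in_vicsek[OF w q])
    qed
  qed
  have centre: "f (\<psi>w v 0) = f 0" if "set v \<subseteq> {1..5}" for v
    using that
  proof (induction v rule: rev_induct)
    case (snoc i v)
    have v: "set v \<subseteq> {1..5}" and i: "i \<in> {1..5}" using snoc.prems by auto
    have 5: "f (\<psi>w (v @ [5]) 0) = f (\<psi>w v 0)"
      using \<psi>_q[of 5] by simp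
    have "f (\<psi>w (v @ [i]) 0) = f (\<psi>w (v @ [5]) 0)"
    proof (cases "i = 5")
      case False
      with i have i4: "i \<in> {1..4}" by auto
      \<comment> \<open>From the centre of subcell \<open>i\<close> to its joint with the central
        subcell, then on to the centre of that one, which is also the centre of cell
        \<open>v\<close>.\<close>
      have "f (\<psi>w (v @ [i]) 0) = f (\<psi>w (v @ [i]) (q (opp i)))"
        using corner[OF opp_in[OF i4] snoc.prems] by simp
      also have "\<dots> = f (\<psi>w (v @ [5]) (q i))"
        by (simp add: \<psi>_opp[OF i4])
      also have "\<dots> = f (\<psi>w (v @ [5]) 0)"
        using v by (intro corner[OF i4]) auto
      finally show ?thesis .
    qed simp
    with 5 snoc.IH[OF v] show ?case by simp
  qed simp
  have "f x = f 0" if x: "x \<in> vicsek" for x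
  proof -
    have "\<forall>n. \<exists>w. w \<in> words {1..5} n \<and> x \<in> cell w"
      using ex_cell[OF x] by blast
    then obtain w where w: "\<And>n. w n \<in> words {1..5} n" "\<And>n. x \<in> cell (w n)"
      by metis
    have w': "set (w n) \<subseteq> {1..5}" "length (w n) = n" for n
      using w(1)[of n] by (auto simp: words_def)
    have 0: "0 \<in> vicsek" using q_in_vicsek[of 5] by simp
    have "(\<lambda>n. \<psi>w (w n) 0) \<longlonglongrightarrow> x"
    proof (rule tendsto_dist_iff[THEN iffD2])
      have "dist (\<psi>w (w n) 0) x \<le> (1/3) ^ n" for n
      proof -
        obtain y where y: "y \<in> vicsek" "x = \<psi>w (w n) y" using w(2)[of n] by blast
        then show ?thesis
          using norm_vicsek_le[OF y(1)] by (simp add: dist_\<psi>w w' mult_left_le)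
      qed
      moreover have "(\<lambda>n. (1/3::real) ^ n) \<longlonglongrightarrow> 0"
        by (intro LIMSEQ_power_zero) simp
      ultimately show "(\<lambda>n. dist (\<psi>w (w n) 0) x) \<longlonglongrightarrow> 0"
        by (intro Lim_null_comparison[of "\<lambda>n. dist (\<psi>w (w n) 0) x" "\<lambda>n. (1/3) ^ n"]) simp_all
    qed
    then have "(\<lambda>n. f (\<psi>w (w n) 0)) \<longlonglongrightarrow> f x"
      using \<psi>w_in_vicsek[OF w'(1) 0] by (rule continuous_on_vicsek_sequentially[OF f])
    moreover have "(\<lambda>n. f (\<psi>w (w n) 0)) \<longlonglongrightarrow> f 0"
      using centre[OF w'(1)] by simp
    ultimately show ?thesis by (rule LIMSEQ_unique)
  qed
  then show ?thesis
    by (auto simp: constant_on_def)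
qed

theorem proposition4p8:
  fixes p :: real
    and f :: "real \<times> real \<Rightarrow> real"
    and d :: "real \<times> real \<Rightarrow> real \<times> real \<Rightarrow> real"
    and \<mu> :: "(real \<times> real) measure"
  assumes "1 < p"
    and "is_geodesic_dist d"
    and "is_vicsek_measure \<mu>"
    and "continuous_on vicsek f"
    and "\<exists>g N. Lp_fun p \<mu> g \<and> N \<in> null_sets \<mu> \<and>
           (\<forall>x\<in>vicsek - N. \<forall>y\<in>vicsek - N.
              \<bar>f x - f y\<bar> \<le> d x y powr \<alpha> p * (g x + g y))"
  shows "f constant_on vicsek"
proof -
  obtain g N where "Lp_fun p \<mu> g" "N \<in> null_sets \<mu>"
      "\<And>x y. x \<in> vicsek - N \<Longrightarrow> y \<in> vicsek - N \<Longrightarrow> \<bar>f x - f y\<bar> \<le> d x y powr \<alpha> p * (g x + g y)"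
    using assms(5) by blast
  note Hajlasz_diagonal_eq[OF assms(1-4) this]
  then show ?thesis
    by (rule constant_on_vicsek_if_diagonal_eq[OF assms(4)])
qed

end
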